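(* There is an absolute constant $c>0$ such that the following holds for all $n$ and all $\Delta\ge 2$: for any randomized comparison-based algorithm that finds the minimum of $n$ elements and in which every element participates in at most $\Delta$ comparisons, there is an input on which the expected number of comparisons in which the minimum participates is at least $c\log_\Delta n$. In short, the expected fragile complexity of the minimum is $\Omega(\log_\Delta n)$.
   Context: Elements come from a totally ordered set and are accessed only through comparisons. The fragile complexity of an element is the number of comparisons it participates in. *)

theory Defs
  imports "HOL-Probability.Probability"
begin

text \<open>
  The input consists of \<open>n\<close> elements named \<open>0, ..., n - 1\<close>; what varies from one input to another
  is the linear order \<open>r\<close> on them, where \<open>(i, j) \<in> r\<close> means that element \<open>i\<close> is at most element \<open>j\<close>.
\<close>

definition is_minimum :: "nat \<Rightarrow> (nat \<times> nat) set \<Rightarrow> nat \<Rightarrow> bool" where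
  "is_minimum n r m \<longleftrightarrow> m < n \<and> (\<forall>j<n. (m, j) \<in> r)"

text \<open>
  Deterministic comparison-based algorithms are decision trees: \<open>Compare i j s t\<close> compares
  element \<open>i\<close> with element \<open>j\<close> and continues with \<open>s\<close> if \<open>i\<close> is the smaller one, with \<open>t\<close> otherwise.
\<close>

datatype decision_tree = Return nat | Compare nat nat decision_tree decision_tree

primrec well_formed :: "nat \<Rightarrow> decision_tree \<Rightarrow> bool" where
  "well_formed n (Return i) \<longleftrightarrow> i < n"
| "well_formed n (Compare i j s t) \<longleftrightarrow>
     i < n \<and> j < n \<and> i \<noteq> j \<and> well_formed n s \<and> well_formed n t"

primrec returned_element :: "(nat \<times> nat) set \<Rightarrow> decision_tree \<Rightarrow> nat" where
  "returned_element r (Return i) = i"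
| "returned_element r (Compare i j s t) = (if (i, j) \<in> r then returned_element r s else returned_element r t)"

primrec fragile_complexity :: "(nat \<times> nat) set \<Rightarrow> nat \<Rightarrow> decision_tree \<Rightarrow> nat" where
  "fragile_complexity r k (Return i) = 0"
| "fragile_complexity r k (Compare i j s t) =
     (if k = i \<or> k = j then 1 else 0) +
     (if (i, j) \<in> r then fragile_complexity r k s else fragile_complexity r k t)"

definition finds_minimum :: "nat \<Rightarrow> decision_tree \<Rightarrow> bool" where
  "finds_minimum n t \<longleftrightarrow> (\<forall>r. linear_order_on {..<n} r \<longrightarrow> is_minimum n r (returned_element r t))"

definition fragile_bounded :: "nat \<Rightarrow> real \<Rightarrow> decision_tree \<Rightarrow> bool" where
  "fragile_bounded n \<Delta> t \<longleftrightarrow>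
     (\<forall>r. linear_order_on {..<n} r \<longrightarrow> (\<forall>k<n. real (fragile_complexity r k t) \<le> \<Delta>))"

text \<open>
  A randomized algorithm is a probability distribution over deterministic ones. As the type of
  decision trees is countable, nothing is lost by using \<open>pmf\<close> instead of general measures, and
  ``for all trees in the support'' is the same as ``almost surely''. The distribution has to be
  independent of the input order; correctness and the bound \<open>\<Delta>\<close> are required with probability 1.
\<close>

definition randomized_minimum_algorithm :: "nat \<Rightarrow> real \<Rightarrow> decision_tree pmf \<Rightarrow> bool" where
  "randomized_minimum_algorithm n \<Delta> A \<longleftrightarrow>
     (\<forall>t\<in>set_pmf A. well_formed n t \<and> finds_minimum n t \<and> fragile_bounded n \<Delta> t)"

definition expected_fragile_complexity ::
  "(nat \<times> nat) set \<Rightarrow> nat \<Rightarrow> decision_tree pmf \<Rightarrow> real" where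
  "expected_fragile_complexity r k A =
     measure_pmf.expectation A (\<lambda>t. real (fragile_complexity r k t))"

end

theory Submission
  imports Defs
begin

text \<open>
  By averaging, it suffices to treat a deterministic tree on random inputs. Let \<open>D \<ge> 4 * \<Delta>\<close>; all
  elements get independent uniform values in \<open>{1..D ^ K}\<close>, except for a uniformly random element
  \<open>x\<close>, which gets the value 0. For each level \<open>j < K\<close>, consider the first opponent \<open>y\<close> of \<open>x\<close> whose
  value is at most \<open>q = D ^ (K - j)\<close>. Up to that comparison the run does not change if \<open>x\<close> gets an
  arbitrary value in \<open>{1..q}\<close>, which is what an ordinary element has with probability \<open>D ^ -j\<close>.
  Hence the event that \<open>y\<close> skips the level, i.e. has value at most \<open>q / D\<close>, can be charged to \<open>y\<close>:
  there are \<open>n * D ^ -(j + 1)\<close> such \<open>y\<close> on average, each with at most \<open>\<Delta>\<close> opponents, so the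
  probability of the event is at most \<open>\<Delta> / D\<close>. Likewise \<open>y\<close> fails to exist with
  probability at most \<open>D ^ j / n\<close>, as only one element is returned. So \<open>x\<close> meets an opponent in
  each level with probability at least 1/4 as long as \<open>2 * D ^ j \<le> n\<close>.
\<close>

section \<open>Orders from values, and lists of opponents\<close>

text \<open>Ties are broken by index, so every assignment of values, injective or not, yields a
  linear order.\<close>

definition value_order :: "nat \<Rightarrow> (nat \<Rightarrow> nat) \<Rightarrow> (nat \<times> nat) set" where
  "value_order n u = {(i, j). i < n \<and> j < n \<and> (u i < u j \<or> u i = u j \<and> i \<le> j)}"

lemma mem_value_order:
  "(i, j) \<in> value_order n u \<longleftrightarrow> i < n \<and> j < n \<and> (u i < u j \<or> u i = u j \<and> i \<le> j)"
  by (simp add: value_order_def)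

text \<open>A list in order of comparison, with repetitions: \<open>List.find\<close> then picks the
  first opponent of low value, and the length is the fragile complexity.\<close>

primrec opponents :: "(nat \<times> nat) set \<Rightarrow> nat \<Rightarrow> decision_tree \<Rightarrow> nat list" where
  "opponents r k (Return i) = []"
| "opponents r k (Compare i j s t) =
     (if k = i then [j] else if k = j then [i] else []) @
     (if (i, j) \<in> r then opponents r k s else opponents r k t)"

lemma linear_order_on_value_order: "linear_order_on {..<n} (value_order n u)"
  unfolding linear_order_on_def partial_order_on_def preorder_on_def
  by (auto simp: value_order_def refl_on_def total_on_def intro!: antisymI transI)

lemma length_opponents: "length (opponents r k t) = fragile_complexity r k t"
  by (induction t) auto

lemma set_opponents_subset: "well_formed n t \<Longrightarrow> set (opponents r x t) \<subseteq> {..<n} - {x}"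
  using [[simproc del: list_to_set_comprehension]] by (induction t) auto

lemma is_minimum_planted:
  assumes "x < n" "w x = 0" "\<And>i. i < n \<Longrightarrow> i \<noteq> x \<Longrightarrow> 0 < w i"
  shows "is_minimum n (value_order n w) x"
  using assms by (force simp: is_minimum_def value_order_def)

lemma is_minimum_unique:
  assumes "linear_order_on {..<n} r" "is_minimum n r x" "is_minimum n r y"
  shows "x = y"
  using assms unfolding linear_order_on_def partial_order_on_def is_minimum_def antisym_def
  by blast

text \<open>Raising the value of the planted minimum from 0 to \<open>v\<close> is invisible until it meets an
  opponent of value at most \<open>q \<ge> v\<close>.\<close>

lemma opponent_after_raise:
  assumes "well_formed n t" "w x = 0" "v \<le> q"
    and "List.find (\<lambda>y. w y \<le> q) (opponents (value_order n w) x t) = Some y"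
  shows "x \<in> set (opponents (value_order n (w(x := v))) y t)"
  using assms by (induction t) (auto simp: mem_value_order split: if_split_asm)

lemma returned_after_raise:
  assumes "well_formed n t" "w x = 0" "v \<le> q"
    and "List.find (\<lambda>y. w y \<le> q) (opponents (value_order n w) x t) = None"
  shows "returned_element (value_order n (w(x := v))) t = returned_element (value_order n w) t"
  using assms by (induction t) (auto simp: mem_value_order split: if_split_asm)

section \<open>Resampling one value, and counting levels\<close>

text \<open>An input \<open>u\<close> amounts to the pair of \<open>u(x := 0)\<close> and
  \<open>u x\<close>, and these two vary independently.\<close>

lemma card_resample_product:
  assumes "x < n" "T \<subseteq> {1..N}" "N > 0"
  shows "card {u \<in> {..<n} \<rightarrow>\<^sub>E {1..N::nat}. X (u(x := 0)) \<and> u x \<in> T} =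
    card {w \<in> (\<lambda>u. u(x := 0)) ` ({..<n} \<rightarrow>\<^sub>E {1..N}). X w} * card T"
proof -
  let ?W = "{w \<in> (\<lambda>u. u(x := 0)) ` ({..<n} \<rightarrow>\<^sub>E {1..N}). X w}"
  have "bij_betw (\<lambda>u. (u(x := 0), u x))
      {u \<in> {..<n} \<rightarrow>\<^sub>E {1..N}. X (u(x := 0)) \<and> u x \<in> T} (?W \<times> T)"
    using assms
    by (intro bij_betwI[where g = "\<lambda>(w, v). w(x := v)"])
       (auto simp: fun_upd_idem PiE_iff extensional_def)
  then show ?thesis
    unfolding card_cartesian_product[symmetric] by (rule bij_betw_same_card)
qed

text \<open>An event depending only on \<open>u(x := 0)\<close> is independent of
  \<open>u x \<le> q\<close>, which has probability \<open>q / N\<close>. This links planted inputs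
  to ordinary ones.\<close>

lemma card_resample:
  assumes "x < n" "q \<le> N" "N > 0"
  shows "card {u \<in> {..<n} \<rightarrow>\<^sub>E {1..N::nat}. X (u(x := 0)) \<and> u x \<le> q} * N =
    card {u \<in> {..<n} \<rightarrow>\<^sub>E {1..N}. X (u(x := 0))} * q"
proof -
  have "{u \<in> {..<n} \<rightarrow>\<^sub>E {1..N}. X (u(x := 0)) \<and> u x \<le> q} =
      {u \<in> {..<n} \<rightarrow>\<^sub>E {1..N}. X (u(x := 0)) \<and> u x \<in> {1..q}}"
    using assms by (auto simp: PiE_iff Ball_def)
  moreover have "{u \<in> {..<n} \<rightarrow>\<^sub>E {1..N}. X (u(x := 0))} =
      {u \<in> {..<n} \<rightarrow>\<^sub>E {1..N}. X (u(x := 0)) \<and> u x \<in> {1..N}}"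
    using assms by (auto simp: PiE_iff)
  ultimately show ?thesis
    using card_resample_product[OF assms(1) _ assms(3), of "{1..q}" X]
      card_resample_product[OF assms(1) _ assms(3), of "{1..N}" X] assms(2) by simp
qed

lemma card_filter:
  assumes "finite A"
  shows "card {x \<in> A. P x} = (\<Sum>x\<in>A. of_bool (P x))"
  using assms by (simp add: Int_def)

lemma sum_card_filter_swap:
  assumes "finite A" "finite B"
  shows "(\<Sum>x\<in>A. card {u \<in> B. P x u}) = (\<Sum>u\<in>B. card {x \<in> A. P x u})"
  unfolding card_filter[OF assms(1)] card_filter[OF assms(2)] by (rule sum.swap)

text \<open>The intervals between consecutive values of \<open>Q\<close> are disjoint, so each entry
  of \<open>ys\<close> accounts for at most one level.\<close>

lemma card_levels_le:
  fixes Q :: "nat \<Rightarrow> nat"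
  assumes "antimono Q"
  shows "card {j \<in> J. \<exists>y\<in>set ys. Q (Suc j) < w y \<and> w y \<le> Q j} \<le> length ys"
proof -
  let ?I = "\<lambda>y. {j \<in> J. Q (Suc j) < w y \<and> w y \<le> Q j}"
  have eq: "a = b" if "a \<in> ?I y" "b \<in> ?I y" for a b y
  proof (rule ccontr)
    assume "a \<noteq> b"
    then consider "Suc a \<le> b" | "Suc b \<le> a" by linarith
    then show False
    proof cases
      case 1
      then show ?thesis using that antimonoD[OF assms 1] by simp
    next
      case 2
      then show ?thesis using that antimonoD[OF assms 2] by simp
    qed
  qed
  have one: "card (?I y) \<le> 1" for y
  proof (cases "\<exists>a. a \<in> ?I y")
    case True
    then obtain a where "a \<in> ?I y" by blast
    then have "?I y \<subseteq> {a}" using eq by blast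
    then show ?thesis using card_mono[of "{a}" "?I y"] by simp
  next
    case False
    then have "?I y = {}" by blast
    then show ?thesis by (simp only: card.empty)
  qed
  have "{j \<in> J. \<exists>y\<in>set ys. Q (Suc j) < w y \<and> w y \<le> Q j} = (\<Union>y\<in>set ys. ?I y)"
    by auto
  also have "card \<dots> \<le> (\<Sum>y\<in>set ys. card (?I y))"
    by (intro card_UN_le) simp
  also have "\<dots> \<le> (\<Sum>y\<in>set ys. 1)"
    using one by (rule sum_mono)
  also have "\<dots> \<le> length ys" by (simp add: card_length)
  finally show ?thesis .
qed

text \<open>If no opponent lies in the level, then the first one of value at most \<open>q\<close>,
  if any, has skipped it.\<close>

lemma find_le_trichotomy:
  fixes w :: "'a \<Rightarrow> nat"
  assumes "\<not> (\<exists>y\<in>set ys. q' < w y \<and> w y \<le> q)"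
  shows "List.find (\<lambda>y. w y \<le> q) ys = None \<or>
    (\<exists>y. List.find (\<lambda>y. w y \<le> q) ys = Some y \<and> w y \<le> q')"
proof (cases "List.find (\<lambda>y. w y \<le> q) ys")
  case (Some y)
  then have "y \<in> set ys" "w y \<le> q" by (auto simp: find_Some_iff)
  then show ?thesis using assms Some by force
qed simp

section \<open>Bounds for unmet and skipped levels\<close>

text \<open>A planted minimum that meets no opponent of value at most \<open>q\<close> is still returned after its
  value is raised into \<open>{1..q}\<close>, and each input returns only one element.\<close>

lemma sum_card_unmet_le:
  fixes N q :: nat
  assumes wf: "well_formed n t" and fm: "finds_minimum n t" and q: "0 < q" "q \<le> N"
  shows "(\<Sum>x<n. card {u \<in> {..<n} \<rightarrow>\<^sub>E {1..N}. List.find (\<lambda>y. (u(x := 0)) y \<le> q)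
            (opponents (value_order n (u(x := 0))) x t) = None}) * q
       \<le> N * card ({..<n} \<rightarrow>\<^sub>E {1..N})"
proof -
  let ?U = "{..<n} \<rightarrow>\<^sub>E {1..N}"
  let ?F = "\<lambda>x w. List.find (\<lambda>y. w y \<le> q) (opponents (value_order n w) x t) = None"
  have fin: "finite ?U" by (intro finite_PiE) auto
  have "(\<Sum>x<n. card {u \<in> ?U. ?F x (u(x := 0))}) * q =
      (\<Sum>x<n. card {u \<in> ?U. ?F x (u(x := 0)) \<and> u x \<le> q} * N)"
    unfolding sum_distrib_right
    using q by (intro sum.cong refl card_resample[where X = "?F x" for x, symmetric]) auto
  also have "\<dots> \<le> (\<Sum>x<n. card {u \<in> ?U. returned_element (value_order n u) t = x} * N)"
  proof (intro sum_mono mult_right_mono card_mono subsetI)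
    fix x u assume x: "x \<in> {..<n}" and u: "u \<in> {u \<in> ?U. ?F x (u(x := 0)) \<and> u x \<le> q}"
    \<comment> \<open>As \<open>(u(x := 0))(x := u x)\<close> is \<open>u\<close>, the raised run is
      the run on an ordinary input.\<close>
    have "returned_element (value_order n ((u(x := 0))(x := u x))) t =
        returned_element (value_order n (u(x := 0))) t"
      using u by (intro returned_after_raise[OF wf, of _ _ _ q]) auto
    moreover have "is_minimum n (value_order n (u(x := 0))) x"
      using x u by (intro is_minimum_planted) (auto simp: PiE_iff Suc_le_eq)
    then have "returned_element (value_order n (u(x := 0))) t = x"
      using fm linear_order_on_value_order is_minimum_unique unfolding finds_minimum_def by blast
    ultimately show "u \<in> {u \<in> ?U. returned_element (value_order n u) t = x}"
      using u by simp
  qed (use fin in auto)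
  also have "\<dots> = (\<Sum>u\<in>?U. card {x \<in> {..<n}. returned_element (value_order n u) t = x}) * N"
    unfolding sum_distrib_right[symmetric] sum_card_filter_swap[OF finite_lessThan fin] ..
  also have "\<dots> \<le> (\<Sum>u\<in>?U. 1) * N"
  proof (intro mult_right_mono sum_mono)
    fix u
    have "card {x \<in> {..<n}. returned_element (value_order n u) t = x}
        \<le> card {returned_element (value_order n u) t}"
      by (intro card_mono) auto
    then show "card {x \<in> {..<n}. returned_element (value_order n u) t = x} \<le> 1" by simp
  qed simp
  finally show ?thesis by (simp add: mult.commute)
qed

text \<open>After raising the planted minimum into \<open>{1..q}\<close>, the comparison is charged to the opponent
  \<open>y\<close>, which can pay for at most \<open>\<Delta>\<close> of them.\<close>

lemma sum_card_jump_le: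
  fixes N q q' :: nat and \<Delta> :: real
  assumes wf: "well_formed n t" and fb: "fragile_bounded n \<Delta> t"
    and q: "0 < q" "q \<le> N" "q' \<le> q"
  shows "real (\<Sum>x<n. card {u \<in> {..<n} \<rightarrow>\<^sub>E {1..N}. \<exists>y. List.find (\<lambda>y. (u(x := 0)) y \<le> q)
            (opponents (value_order n (u(x := 0))) x t) = Some y \<and> (u(x := 0)) y \<le> q'}) * q
       \<le> n * \<Delta> * q' * card ({..<n} \<rightarrow>\<^sub>E {1..N})"
proof -
  let ?U = "{..<n} \<rightarrow>\<^sub>E {1..N}"
  let ?B = "\<lambda>x w. \<exists>y. List.find (\<lambda>y. w y \<le> q)
    (opponents (value_order n w) x t) = Some y \<and> w y \<le> q'"
  \<comment> \<open>The charged event no longer mentions planting: it concerns the run on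
    \<open>u\<close> alone.\<close>
  let ?C = "\<lambda>x y u. u y \<le> q' \<and> x \<in> set (opponents (value_order n u) y t)"
  have fin: "finite ?U" by (intro finite_PiE) auto
  have "(\<Sum>x<n. card {u \<in> ?U. ?B x (u(x := 0))}) * q =
      (\<Sum>x<n. card {u \<in> ?U. ?B x (u(x := 0)) \<and> u x \<le> q} * N)"
    unfolding sum_distrib_right
    using q by (intro sum.cong refl card_resample[where X = "?B x" for x, symmetric]) auto
  also have "\<dots> \<le> (\<Sum>x<n. (\<Sum>y<n. card {u \<in> ?U. ?C x y u}) * N)"
  proof (intro sum_mono mult_right_mono)
    fix x
    have "{u \<in> ?U. ?B x (u(x := 0)) \<and> u x \<le> q} \<subseteq> (\<Union>y<n. {u \<in> ?U. ?C x y u})"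
    proof
      fix u assume u: "u \<in> {u \<in> ?U. ?B x (u(x := 0)) \<and> u x \<le> q}"
      then obtain y where f: "List.find (\<lambda>y. (u(x := 0)) y \<le> q)
            (opponents (value_order n (u(x := 0))) x t) = Some y" and y: "(u(x := 0)) y \<le> q'"
        by blast
      have "y \<in> set (opponents (value_order n (u(x := 0))) x t)"
        using f by (auto simp: find_Some_iff)
      then have "y < n" "y \<noteq> x" using set_opponents_subset[OF wf] by blast+
      moreover have "x \<in> set (opponents (value_order n ((u(x := 0))(x := u x))) y t)"
        using u f by (intro opponent_after_raise[OF wf, of _ _ _ q]) auto
      ultimately show "u \<in> (\<Union>y<n. {u \<in> ?U. ?C x y u})" using u y by auto
    qed
    then have "card {u \<in> ?U. ?B x (u(x := 0)) \<and> u x \<le> q} \<le> card (\<Union>y<n. {u \<in> ?U. ?C x y u})"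
      using fin by (intro card_mono) auto
    also have "\<dots> \<le> (\<Sum>y<n. card {u \<in> ?U. ?C x y u})" by (intro card_UN_le) simp
    finally show "card {u \<in> ?U. ?B x (u(x := 0)) \<and> u x \<le> q} \<le> (\<Sum>y<n. card {u \<in> ?U. ?C x y u})" .
  qed simp
  also have "\<dots> = (\<Sum>y<n. \<Sum>x<n. card {u \<in> ?U. ?C x y u}) * N"
    unfolding sum_distrib_right[symmetric] by (rule arg_cong[OF sum.swap])
  also have "\<dots> = (\<Sum>y<n. \<Sum>u\<in>?U. card {x \<in> {..<n}. ?C x y u}) * N"
    unfolding sum_card_filter_swap[OF finite_lessThan fin] ..
  finally have 1: "real (\<Sum>x<n. card {u \<in> ?U. ?B x (u(x := 0))}) * q \<le>
      real (\<Sum>y<n. \<Sum>u\<in>?U. card {x \<in> {..<n}. ?C x y u}) * N"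
    unfolding of_nat_mult[symmetric] by (rule of_nat_mono)
  \<comment> \<open>The event \<open>u y \<le> q'\<close> has probability \<open>q' / N\<close>, and
    on it at most \<Delta> elements \<open>x\<close> are counted.\<close>
  have 2: "real (\<Sum>u\<in>?U. card {x \<in> {..<n}. ?C x y u}) * N \<le> \<Delta> * q' * card ?U"
    if y: "y < n" for y
  proof -
    have "real (card {x \<in> {..<n}. ?C x y u}) \<le> (if u y \<le> q' then \<Delta> else 0)" for u
    proof (cases "u y \<le> q'")
      case True
      have "card {x \<in> {..<n}. ?C x y u} \<le> card (set (opponents (value_order n u) y t))"
        by (intro card_mono) auto
      also have "\<dots> \<le> fragile_complexity (value_order n u) y t"
        unfolding length_opponents[symmetric] by (rule card_length)
      finally have "real (card {x \<in> {..<n}. ?C x y u}) \<le> fragile_complexity (value_order n u) y t"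
        by simp
      also have "\<dots> \<le> \<Delta>"
        using fb y linear_order_on_value_order unfolding fragile_bounded_def by blast
      finally show ?thesis using True by simp
    qed simp
    then have "real (\<Sum>u\<in>?U. card {x \<in> {..<n}. ?C x y u}) \<le> (\<Sum>u\<in>?U. if u y \<le> q' then \<Delta> else 0)"
      unfolding of_nat_sum by (intro sum_mono)
    also have "\<dots> = \<Delta> * card {u \<in> ?U. u y \<le> q'}"
      unfolding sum.inter_filter[OF fin, symmetric] by simp
    finally have "real (\<Sum>u\<in>?U. card {x \<in> {..<n}. ?C x y u}) * N \<le>
        \<Delta> * real (card {u \<in> ?U. u y \<le> q'} * N)"
      unfolding of_nat_mult mult.assoc[symmetric] by (intro mult_right_mono) auto
    also have "card {u \<in> ?U. u y \<le> q'} * N = card ?U * q'"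
      using card_resample[of y n q' N "\<lambda>_. True"] y q by simp
    finally show ?thesis by (simp only: of_nat_mult mult_ac)
  qed
  have "real (\<Sum>y<n. \<Sum>u\<in>?U. card {x \<in> {..<n}. ?C x y u}) * N =
      (\<Sum>y<n. real (\<Sum>u\<in>?U. card {x \<in> {..<n}. ?C x y u}) * N)"
    by (simp only: of_nat_sum sum_distrib_right)
  also have "\<dots> \<le> (\<Sum>y<n. \<Delta> * q' * card ?U)"
    by (intro sum_mono 2) simp
  also have "\<dots> = n * \<Delta> * q' * card ?U" by simp
  finally show ?thesis using 1 by (rule order_trans[rotated])
qed

section \<open>Lower bound for a single decision tree\<close>

text \<open>Each of the \<open>K\<close> levels is met, unmet (\<open>F\<close>) or skipped
  (\<open>B\<close>). Over random \<open>x\<close> and \<open>u\<close>, \<open>F\<close> has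
  probability at most 1/2 and \<open>B\<close> at most 1/4, which leaves 1/4 per level.\<close>

lemma sum_fragile_complexity_ge:
  fixes D K :: nat and \<Delta> :: real
  assumes wf: "well_formed n t" and fm: "finds_minimum n t" and fb: "fragile_bounded n \<Delta> t"
    and D: "D > 0" "4 * \<Delta> \<le> D" and K: "\<And>j. j < K \<Longrightarrow> 2 * D ^ j \<le> n"
  shows "real (n * card ({..<n} \<rightarrow>\<^sub>E {1..D ^ K})) * (K / 4) \<le>
    (\<Sum>x<n. \<Sum>u\<in>{..<n} \<rightarrow>\<^sub>E {1..D ^ K}. fragile_complexity (value_order n (u(x := 0))) x t)"
    (is "real (n * card ?U) * _ \<le> _")
proof -
  \<comment> \<open>Truncated subtraction keeps \<open>Q\<close> at 1 from \<open>K\<close> on, so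
    it is antitone on all of \<open>nat\<close>.\<close>
  define Q where "Q = (\<lambda>j. D ^ (K - j))"
  define F where "F = (\<lambda>j x w. List.find (\<lambda>y. w y \<le> Q j) (opponents (value_order n w) x t) = None)"
  define B where "B = (\<lambda>j x w. \<exists>y. List.find (\<lambda>y. w y \<le> Q j)
    (opponents (value_order n w) x t) = Some y \<and> w y \<le> Q (Suc j))"
  have fin: "finite ?U" by (intro finite_PiE) auto
  have anti: "antimono Q"
    unfolding Q_def using D by (intro antimonoI power_increasing) auto
  have pos: "0 < Q j" and leN: "Q j \<le> D ^ K" for j
    unfolding Q_def using D by (auto intro!: power_increasing)
  have pt: "K \<le> fragile_complexity (value_order n w) x t +
      (\<Sum>j<K. of_bool (F j x w) + of_bool (B j x w))" for x w
  proof -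
    let ?P = "\<lambda>j. \<exists>y\<in>set (opponents (value_order n w) x t). Q (Suc j) < w y \<and> w y \<le> Q j"
    have "K = (\<Sum>j<K. 1)" by simp
    also have "\<dots> \<le> (\<Sum>j<K. of_bool (?P j) + (of_bool (F j x w) + of_bool (B j x w)))"
    proof (rule sum_mono)
      fix j
      show "1 \<le> (of_bool (?P j) + (of_bool (F j x w) + of_bool (B j x w)) :: nat)"
      proof (cases "?P j")
        case False
        then have "F j x w \<or> B j x w"
          unfolding F_def B_def by (rule find_le_trichotomy)
        then show ?thesis by auto
      qed simp
    qed
    also have "\<dots> = card {j \<in> {..<K}. ?P j} + (\<Sum>j<K. of_bool (F j x w) + of_bool (B j x w))"
      unfolding card_filter[OF finite_lessThan] by (rule sum.distrib)
    also have "card {j \<in> {..<K}. ?P j} \<le> fragile_complexity (value_order n w) x t"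
      unfolding length_opponents[symmetric] by (rule card_levels_le[OF anti])
    finally show ?thesis by simp
  qed
  have cF: "real (\<Sum>x<n. card {u \<in> ?U. F j x (u(x := 0))}) \<le> n * card ?U / 2" if j: "j < K" for j
  proof -
    have N: "D ^ K = D ^ j * Q j" using j by (simp add: Q_def flip: power_add)
    have "(\<Sum>x<n. card {u \<in> ?U. F j x (u(x := 0))}) * Q j \<le> D ^ K * card ?U"
      unfolding F_def by (intro sum_card_unmet_le wf fm pos leN)
    also have "\<dots> = (D ^ j * card ?U) * Q j" by (subst N) simp
    finally have "(\<Sum>x<n. card {u \<in> ?U. F j x (u(x := 0))}) \<le> D ^ j * card ?U"
      by (rule mult_right_le_imp_le) (rule pos)
    then have "2 * (\<Sum>x<n. card {u \<in> ?U. F j x (u(x := 0))}) \<le> 2 * D ^ j * card ?U"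
      unfolding mult.assoc by (rule mult_left_mono) simp
    also have "\<dots> \<le> n * card ?U" using K[OF j] by (rule mult_right_mono) simp
    finally have "real (2 * (\<Sum>x<n. card {u \<in> ?U. F j x (u(x := 0))})) \<le> real (n * card ?U)"
      by (rule of_nat_mono)
    then show ?thesis unfolding of_nat_mult by simp
  qed
  have cB: "real (\<Sum>x<n. card {u \<in> ?U. B j x (u(x := 0))}) \<le> n * card ?U / 4" if j: "j < K" for j
  proof -
    \<comment> \<open>One level is a factor of \<open>D\<close>, which absorbs
      \<open>4 * \<Delta>\<close>.\<close>
    have QS: "Q j = D * Q (Suc j)" using j by (simp add: Q_def Suc_diff_Suc flip: power_Suc)
    have "real (\<Sum>x<n. card {u \<in> ?U. B j x (u(x := 0))}) * Q j \<le> n * \<Delta> * Q (Suc j) * card ?U"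
      unfolding B_def by (intro sum_card_jump_le wf fb pos leN antimonoD[OF anti]) simp
    also have "\<dots> \<le> n * (D / 4) * Q (Suc j) * card ?U"
      using D by (intro mult_right_mono mult_left_mono) auto
    also have "\<dots> = n * card ?U / 4 * Q j" by (simp add: QS)
    finally show ?thesis by (rule mult_right_le_imp_le) (use pos in simp)
  qed
  have swap: "(\<Sum>x<n. \<Sum>u\<in>?U. \<Sum>j<K. of_bool (P j x (u(x := 0)))) =
      (\<Sum>j<K. \<Sum>x<n. card {u \<in> ?U. P j x (u(x := 0))})" for P :: "nat \<Rightarrow> nat \<Rightarrow> (nat \<Rightarrow> nat) \<Rightarrow> bool"
    unfolding card_filter[OF fin] sum.swap[of _ "{..<K}" ?U] by (rule sum.swap)
  let ?S = "\<Sum>x<n. \<Sum>u\<in>?U. fragile_complexity (value_order n (u(x := 0))) x t"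
  have "n * card ?U * K = (\<Sum>x<n. \<Sum>u\<in>?U. K)" by simp
  also have "\<dots> \<le> (\<Sum>x<n. \<Sum>u\<in>?U. fragile_complexity (value_order n (u(x := 0))) x t +
      (\<Sum>j<K. of_bool (F j x (u(x := 0))) + of_bool (B j x (u(x := 0)))))"
    by (intro sum_mono pt)
  also have "\<dots> = ?S + (\<Sum>j<K. (\<Sum>x<n. card {u \<in> ?U. F j x (u(x := 0))}) +
        (\<Sum>x<n. card {u \<in> ?U. B j x (u(x := 0))}))"
    unfolding sum.distrib swap ..
  finally have "real (n * card ?U * K) \<le> real (?S + (\<Sum>j<K.
        (\<Sum>x<n. card {u \<in> ?U. F j x (u(x := 0))}) + (\<Sum>x<n. card {u \<in> ?U. B j x (u(x := 0))})))"
    by (rule of_nat_mono)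
  also have "\<dots> = real ?S + (\<Sum>j<K. real (\<Sum>x<n. card {u \<in> ?U. F j x (u(x := 0))}) +
        real (\<Sum>x<n. card {u \<in> ?U. B j x (u(x := 0))}))"
    by (simp only: of_nat_add of_nat_sum)
  also have "\<dots> \<le> real ?S + (\<Sum>j<K. n * card ?U / 2 + n * card ?U / 4)"
    by (intro add_left_mono sum_mono add_mono cF cB) auto
  also have "\<dots> = real ?S + 3 / 4 * (n * card ?U * K)" by simp
  finally show ?thesis unfolding of_nat_mult by simp
qed

section \<open>Randomized algorithms and the choice of parameters\<close>

text \<open>The easy half of Yao's principle: averaging over planted inputs commutes with the
  expectation over trees, so some input reaches the average.\<close>

lemma exists_hard_input:
  fixes D K :: nat and \<Delta> :: real
  assumes A: "randomized_minimum_algorithm n \<Delta> A" and n: "n > 0"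
    and D: "D > 0" "4 * \<Delta> \<le> D" and K: "\<And>j. j < K \<Longrightarrow> 2 * D ^ j \<le> n"
  shows "\<exists>r m. linear_order_on {..<n} r \<and> is_minimum n r m \<and>
    K / 4 \<le> expected_fragile_complexity r m A"
proof -
  let ?U = "{..<n} \<rightarrow>\<^sub>E {1..D ^ K}"
  let ?r = "\<lambda>x u. value_order n (u(x := 0))"
  have fin: "finite ?U" by (intro finite_PiE) auto
  have ne: "card ?U > 0" using D by (simp add: card_PiE)
  \<comment> \<open>The support of \<open>A\<close> may be infinite; integrability comes from the
    bound \<Delta>.\<close>
  have int: "integrable (measure_pmf A) (\<lambda>t. real (fragile_complexity (?r x u) x t))"
    if "x < n" for x u
    using A that linear_order_on_value_order
    by (intro measure_pmf.integrable_const_bound[of _ \<Delta>])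
       (auto simp: AE_measure_pmf_iff randomized_minimum_algorithm_def fragile_bounded_def)
  have "\<exists>x<n. \<exists>u\<in>?U. K / 4 \<le> expected_fragile_complexity (?r x u) x A"
  proof (rule ccontr)
    assume "\<not> ?thesis"
    then have "(\<Sum>x<n. \<Sum>u\<in>?U. expected_fragile_complexity (?r x u) x A) < (\<Sum>x<n. \<Sum>u\<in>?U. real K / 4)"
      using n ne fin by (intro sum_strict_mono) (auto simp: card_gt_0_iff not_le)
    also have "\<dots> = (\<integral>t. real (n * card ?U) * (K / 4) \<partial>measure_pmf A)" by simp
    also have "\<dots> \<le> (\<integral>t. (\<Sum>x<n. \<Sum>u\<in>?U. real (fragile_complexity (?r x u) x t)) \<partial>measure_pmf A)"
    proof (rule integral_mono_AE)
      show "AE t in measure_pmf A. real (n * card ?U) * (K / 4) \<le>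
          (\<Sum>x<n. \<Sum>u\<in>?U. real (fragile_complexity (?r x u) x t))"
        using A sum_fragile_complexity_ge[OF _ _ _ D K]
        by (auto simp: AE_measure_pmf_iff randomized_minimum_algorithm_def)
    qed (use int in auto)
    also have "\<dots> = (\<Sum>x<n. \<Sum>u\<in>?U. expected_fragile_complexity (?r x u) x A)"
      using int unfolding expected_fragile_complexity_def
      by (subst Bochner_Integration.integral_sum) (auto intro!: sum.cong Bochner_Integration.integral_sum)
    finally show False by simp
  qed
  then obtain x u where "x < n" "u \<in> ?U" "K / 4 \<le> expected_fragile_complexity (?r x u) x A"
    by blast
  moreover from this have "is_minimum n (?r x u) x"
    by (intro is_minimum_planted) (auto simp: PiE_iff Suc_le_eq)
  ultimately show ?thesis using linear_order_on_value_order by blast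
qed

text \<open>The least \<open>K\<close> with \<open>n < 2 * D ^ K\<close> works:
  \<open>n \<ge> 2\<close> forces \<open>K > 0\<close>, and then \<open>2 \<le> D ^ K\<close>
  absorbs the factor 2.\<close>

lemma exists_levels:
  fixes D n :: nat
  assumes "D \<ge> 2" "n \<ge> 2"
  shows "\<exists>K. (\<forall>j<K. 2 * D ^ j \<le> n) \<and> n \<le> D ^ (2 * K)"
proof -
  define K where "K = (LEAST k. n < 2 * D ^ k)"
  have "n < 2 ^ n" by simp
  also have "\<dots> \<le> D ^ n" using assms by (intro power_mono) auto
  finally have "n < 2 * D ^ n" by simp
  then have K: "n < 2 * D ^ K" unfolding K_def by (rule LeastI)
  have "\<forall>j<K. 2 * D ^ j \<le> n" unfolding K_def using not_less_Least not_less by blast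
  moreover have "K > 0" using K assms by (cases K) auto
  then have "2 \<le> D ^ K" using assms self_le_power[of D K] by linarith
  then have "2 * D ^ K \<le> D ^ K * D ^ K" by (rule mult_right_mono) simp
  then have "n \<le> D ^ (2 * K)" using K by (simp add: mult_2 power_add)
  ultimately show ?thesis by blast
qed

theorem theorem10:
  "\<exists>c::real. c > 0 \<and>
     (\<forall>(n::nat) (\<Delta>::real) (A :: decision_tree pmf).
        n \<ge> 1 \<longrightarrow> \<Delta> \<ge> 2 \<longrightarrow> randomized_minimum_algorithm n \<Delta> A \<longrightarrow>
        (\<exists>r m. linear_order_on {..<n} r \<and> is_minimum n r m \<and>
               expected_fragile_complexity r m A \<ge> c * log \<Delta> (real n)))"
proof (intro exI[of _ "1/32"] conjI allI impI)
  fix n :: nat and \<Delta> :: real and A :: "decision_tree pmf"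
  assume n: "n \<ge> 1" and \<Delta>: "\<Delta> \<ge> 2" and A: "randomized_minimum_algorithm n \<Delta> A"
  define D where "D = nat \<lceil>4 * \<Delta>\<rceil>"
  have D: "4 * \<Delta> \<le> D" "D \<le> 4 * \<Delta> + 1" "D > 0" "D \<ge> 2"
    unfolding D_def using \<Delta> by linarith+
  \<comment> \<open>Since \<open>4 * \<Delta> + 1 \<le> 8 * \<Delta> \<le> \<Delta> ^ 4\<close>,
    passing from base \<open>D\<close> to base \<Delta> costs only a factor of 4.\<close>
  have "2 ^ 3 \<le> \<Delta> ^ 3" using \<Delta> by (intro power_mono) auto
  then have "8 * \<Delta> \<le> \<Delta> ^ 3 * \<Delta>" using \<Delta> by (intro mult_right_mono) auto
  also have "\<Delta> ^ 3 * \<Delta> = \<Delta> ^ 4" by (simp add: power4_eq_xxxx power3_eq_cube)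
  finally have D4: "D \<le> \<Delta> ^ 4" using D \<Delta> by linarith
  obtain K where K: "\<And>j. j < K \<Longrightarrow> 2 * D ^ j \<le> n" and Kn: "n \<le> D ^ (2 * K)"
  proof (cases "n = 1")
    \<comment> \<open>Here the logarithm vanishes, so zero levels suffice.\<close>
    case True
    then show ?thesis using that[of 0] by simp
  next
    case False
    then show ?thesis using that exists_levels[of D n] D n by auto
  qed
  have "real n \<le> real D ^ (2 * K)" using Kn by (metis of_nat_le_iff of_nat_power)
  also have "\<dots> \<le> (\<Delta> ^ 4) ^ (2 * K)" using D4 by (intro power_mono) auto
  finally have "real n \<le> \<Delta> ^ (8 * K)" by (simp flip: power_mult)
  then have "log \<Delta> n \<le> log \<Delta> (\<Delta> ^ (8 * K))" using n \<Delta> by (intro log_mono) auto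
  also have "\<dots> = 8 * K" using \<Delta> by (simp add: log_nat_power)
  \<comment> \<open>The constant is 1/4 per level, divided by 8: a factor of 2 from
    \<open>n \<le> D ^ (2 * K)\<close> and 4 from the change of base.\<close>
  finally have "1/32 * log \<Delta> n \<le> K / 4" by simp
  then show "\<exists>r m. linear_order_on {..<n} r \<and> is_minimum n r m \<and>
      expected_fragile_complexity r m A \<ge> 1/32 * log \<Delta> (real n)"
    using exists_hard_input[OF A _ D(3) D(1) K] n by fastforce
qed simp

end
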